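(* Let $\mathcal M$ be a unichain Markov decision process with finite state set $S$, let $s_1,\ldots,s_n\in S$ be $n$ distinct states, and let $\pi_1,\pi_2,\ldots,\pi_{n+1}$ be pairwise distinct policies on $\mathcal M$ that coincide in all states other than $s_1,\ldots,s_n$. Suppose that in each state $s_j$ ($1\le j\le n$) each of the policies applies one of two possible actions, named $0$ and $1$, i.e. for each $i\in\{1,\ldots,n+1\}$ and each $j\in\{1,\ldots,n\}$ either $\pi_i(s_j)=0$ or $\pi_i(s_j)=1$. Let $\mu_i$ denote the stationary distribution of $\pi_i$. Then the stationary distributions of all combinations of $\pi_1,\ldots,\pi_{n+1}$ are uniquely determined by $\mu_1,\ldots,\mu_{n+1}$. More precisely, let $\pi$ be a combination of $\pi_1,\ldots,\pi_{n+1}$, and let the names $0$ and $1$ of the two actions be chosen (by swapping them, separately in each state $s_j$, where necessary) so that $\pi(s_j)=1$ for all $j\in\{1,\ldots,n\}$. For $k\in\{1,\ldots,n+1\}$ put $$\Gamma_k := \{\gamma\in S_{n+1} \mid \gamma(k)=n+1 \text{ and } \pi_j(s_{\gamma(j)})=0 \text{ for all } j\in\{1,\ldots,n+1\},\ j\neq k\}.$$ Then the stationary distribution $\mu$ of $\pi$ satisfies, for every $s\in S$, $$\mu(s)=\frac{\sum_{k=1}^{n+1}\sum_{\gamma\in\Gamma_k}\operatorname{sgn}(\gamma)\,\mu_k(s)\prod_{1\le j\le n+1,\ j\neq k}\mu_j(s_{\gamma(j)})}{\sum_{s'\in S}\sum_{k=1}^{n+1}\sum_{\gamma\in\Gamma_k}\operatorname{sgn}(\gamma)\,\mu_k(s')\prod_{1\le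 j\le n+1,\ j\neq k}\mu_j(s_{\gamma(j)})}.$$
   Context: A Markov decision process (MDP) $\mathcal M$ on a finite set of states $S$ with a finite set of actions $A$ available in each state consists of an initial distribution $\mu_0$ on $S$ and transition probabilities $p_a(i,j)$ specifying the probability of reaching state $j$ when choosing action $a\in A$ in state $i$. A (stationary) policy on $\mathcal M$ is a mapping $\pi:S\to A$; it induces a Markov chain on $S$ with transition matrix $(p_{\pi(i)}(i,j))_{i,j\in S}$. The MDP is called unichain if for each policy $\pi$ the induced Markov chain is ergodic, meaning that the matrix $(p_{\pi(i)}(i,j))_{i,j\in S}$ is irreducible (periodicity is allowed). The stationary distribution of a policy is the unique invariant probability distribution $\mu$ of its induced Markov chain, i.e. $\mu P=\mu$ for the transition matrix $P$, with $\mu$ a row vector. Given policies $\pi_1,\ldots,\pi_m$, a policy $\pi$ is a combination of $\pi_1,\ldots,\pi_m$ if for each state $s$ one has $\pi(s)=\pi_i(s)$ for some $i$ (which may depend on $s$). $S_{m}$ denotes the set of permutations of $\{1,\ldots,m\}$, and $\operatorname{sgn}(\gamma)$ is the sign of the permutation $\gamma$.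
   Formalization: The quotient formula and the unique determination by μ_1,…,μ_{n+1} are proved only when the denominator of the formula is nonzero (both can fail otherwise, e.g. policies 000, 011, 100, 111 with combination 101); without this, only μ(s) times the denominator equals the numerator is proved. *)

theory Defs
  imports "HOL-Analysis.Analysis" "HOL-Probability.Probability_Mass_Function"
    "HOL-Combinatorics.Permutations"
begin

text \<open>States and actions range over the finite types \<open>'s\<close> and \<open>'a\<close>; every action is
  available in every state. \<open>pmf (trans M a i) j\<close> is the probability $p_a(i,j)$.\<close>

record ('s, 'a) mdp =
  init :: "'s pmf"
  trans :: "'a \<Rightarrow> 's \<Rightarrow> 's pmf"

type_synonym ('s, 'a) policy = "'s \<Rightarrow> 'a"

definition transition_matrix :: "('s::finite, 'a::finite) mdp \<Rightarrow> ('s, 'a) policy \<Rightarrow> real ^ 's ^ 's" where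
  "transition_matrix M \<pi> = (\<chi> i j. pmf (trans M (\<pi> i) i) j)"

text \<open>Powers of a square matrix for the matrix product; the overloaded \<open>^\<close> would be the
  componentwise power.\<close>

definition mat_power :: "real ^ 's ^ 's \<Rightarrow> nat \<Rightarrow> real ^ 's ^ 's::finite" where
  "mat_power P m = ((\<lambda>Q. Q ** P) ^^ m) (mat 1)"

definition irreducible_matrix :: "real ^ 's ^ 's::finite \<Rightarrow> bool" where
  "irreducible_matrix P \<longleftrightarrow> (\<forall>i j. \<exists>m>0. mat_power P m $ i $ j > 0)"

definition unichain :: "('s::finite, 'a::finite) mdp \<Rightarrow> bool" where
  "unichain M \<longleftrightarrow> (\<forall>\<pi>. irreducible_matrix (transition_matrix M \<pi>))"

text \<open>For a unichain MDP there is exactly one such \<open>\<mu>\<close> for each policy.\<close>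

definition stationary_distribution :: "('s::finite, 'a::finite) mdp \<Rightarrow> ('s, 'a) policy \<Rightarrow> 's pmf \<Rightarrow> bool" where
  "stationary_distribution M \<pi> \<mu> \<longleftrightarrow>
     (\<chi> i. pmf \<mu> i) v* transition_matrix M \<pi> = (\<chi> i. pmf \<mu> i)"

definition combination :: "nat \<Rightarrow> (nat \<Rightarrow> ('s, 'a) policy) \<Rightarrow> ('s, 'a) policy \<Rightarrow> bool" where
  "combination m pol \<pi> \<longleftrightarrow> (\<forall>x. \<exists>i\<in>{1..m}. \<pi> x = pol i x)"

text \<open>\<open>st j\<close> is the state $s_j$ and \<open>zero j\<close> is the action that is named 0 in it.
  For \<open>\<gamma> k = n + 1\<close> and \<open>j \<noteq> k\<close> one has \<open>\<gamma> j \<in> {1..n}\<close>, so \<open>st\<close> and \<open>zero\<close> are only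
  used at indices in \<open>{1..n}\<close>.\<close>

definition Gamma_set ::
  "nat \<Rightarrow> (nat \<Rightarrow> 's) \<Rightarrow> (nat \<Rightarrow> 'a) \<Rightarrow> (nat \<Rightarrow> ('s, 'a) policy) \<Rightarrow> nat \<Rightarrow> (nat \<Rightarrow> nat) set" where
  "Gamma_set n st zero pol k =
     {\<gamma>. \<gamma> permutes {1..n+1} \<and> \<gamma> k = n + 1 \<and>
          (\<forall>j\<in>{1..n+1}. j \<noteq> k \<longrightarrow> pol j (st (\<gamma> j)) = zero (\<gamma> j))}"

definition numer ::
  "nat \<Rightarrow> (nat \<Rightarrow> 's) \<Rightarrow> (nat \<Rightarrow> 'a) \<Rightarrow> (nat \<Rightarrow> ('s, 'a) policy) \<Rightarrow> (nat \<Rightarrow> 's pmf) \<Rightarrow> 's \<Rightarrow> real" where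
  "numer n st zero pol \<mu> x =
     (\<Sum>k\<in>{1..n+1}. \<Sum>\<gamma>\<in>Gamma_set n st zero pol k.
        of_int (sign \<gamma>) * pmf (\<mu> k) x * (\<Prod>j\<in>{1..n+1} - {k}. pmf (\<mu> j) (st (\<gamma> j))))"

end

theory Submission
  imports Defs
begin

text \<open>
  Write \<open>P\<close> for the transition matrix of the combination \<open>\<pi>\<close>, and let \<open>A k j\<close> be the mass that
  \<open>\<mu>\<^sub>k\<close> puts on \<open>s\<^sub>j\<close> if the \<open>k\<close>-th policy plays 0 there, and 0 otherwise. The chain of the
  \<open>k\<close>-th policy differs from \<open>P\<close> only in those rows \<open>s\<^sub>j\<close> in which that policy plays 0, so the
  defect of \<open>\<mu>\<^sub>k\<close> under \<open>P\<close> is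
  \<open>\<mu>\<^sub>k P - \<mu>\<^sub>k = (\<Sum>j = 1..n. A k j * d j)\<close>,
  where \<open>d j\<close> is the difference of the rows of \<open>s\<^sub>j\<close> under the actions 1 and 0
  (\<open>stationary_defect\<close>). What matters is that \<open>d j\<close> does not depend on \<open>k\<close>: a linear
  combination of the \<open>\<mu>\<^sub>k\<close> with coefficients \<open>c k\<close> is invariant under \<open>P\<close> as soon as
  \<open>(\<Sum>k. c k * A k j) = 0\<close> for all \<open>j\<close>. These are \<open>n\<close> linear equations in \<open>n + 1\<close> unknowns, and
  Cramer's rule solves them: extend \<open>A\<close> by an arbitrary column \<open>n + 1\<close> and take for \<open>c k\<close> the
  cofactor of the entry in row \<open>k\<close> of that column. The equations hold because expanding along a
  wrong column gives the determinant of a matrix with two equal columns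
  (\<open>alien_cofactor_expansion\<close>). Since the permutations outside \<open>\<Gamma>\<^sub>k\<close> meet a zero entry of \<open>A\<close>, the
  numerator of the formula is exactly \<open>(\<Sum>k. c k * \<mu>\<^sub>k)\<close> (\<open>numer_eq_cofactor_sum\<close>).

  If an irreducible nonnegative matrix has a nonzero invariant row vector with nonnegative entries,
  then every invariant row vector, also one with entries of both signs, is a multiple of it
  (\<open>irreducible_invariant_unique\<close>). So the numerator is a multiple of the stationary
  distribution \<open>\<mu>\<close> of \<open>\<pi>\<close>, and summing over all states identifies the factor. The resulting
  formula mentions the process only through the policies and the \<open>\<mu>\<^sub>k\<close>, so it gives the same value
  in every unichain process in which the \<open>\<mu>\<^sub>k\<close> are stationary, provided that its denominator does not
  vanish.
\<close>

section \<open>Cofactors as sums over permutations\<close>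

text \<open>
  The cofactor of the entry in row \<open>k\<close> and column \<open>b\<close> of a matrix with rows and columns indexed
  by \<open>U\<close>, as the part of the Leibniz expansion that uses this entry. It does not depend on
  column \<open>b\<close>.
\<close>

definition leibniz_cofactor :: "'i set \<Rightarrow> ('i \<Rightarrow> 'i \<Rightarrow> real) \<Rightarrow> 'i \<Rightarrow> 'i \<Rightarrow> real" where
  "leibniz_cofactor U A b k =
     (\<Sum>\<gamma> | \<gamma> permutes U \<and> \<gamma> k = b. of_int (sign \<gamma>) * (\<Prod>j\<in>U - {k}. A j (\<gamma> j)))"

text \<open>
  Composing with the transposition of \<open>a\<close> and \<open>b\<close> is a bijection of the permutations of \<open>U\<close> which
  preserves the products and flips the signs, so the sum equals its own negative.
\<close>

lemma leibniz_sum_equal_columns: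
  fixes B :: "'i \<Rightarrow> 'i \<Rightarrow> real"
  assumes U: "finite U" "a \<in> U" "b \<in> U" "a \<noteq> b"
    and eq: "\<And>j. j \<in> U \<Longrightarrow> B j a = B j b"
  shows "(\<Sum>\<gamma> | \<gamma> permutes U. of_int (sign \<gamma>) * (\<Prod>j\<in>U. B j (\<gamma> j))) = 0"
    (is "?S = 0")
proof -
  let ?t = "Transposition.transpose a b"
  have t: "?t permutes U"
    using U by (intro permutes_swap_id)
  have "?S = (\<Sum>\<gamma> | \<gamma> permutes U. of_int (sign (?t \<circ> \<gamma>)) * (\<Prod>j\<in>U. B j ((?t \<circ> \<gamma>) j)))"
    by (rule setum_permutations_compose_left[OF t])
  also have "\<dots> = (\<Sum>\<gamma> | \<gamma> permutes U. - (of_int (sign \<gamma>) * (\<Prod>j\<in>U. B j (\<gamma> j))))"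
  proof (rule sum.cong[OF refl])
    fix \<gamma> assume "\<gamma> \<in> {\<gamma>. \<gamma> permutes U}"
    then have g: "\<gamma> permutes U" by simp
    have "permutation ?t" "permutation \<gamma>"
      using t g U(1) permutation_permutes by blast+
    then have "sign (?t \<circ> \<gamma>) = - sign \<gamma>"
      using U(4) by (simp add: sign_compose sign_swap_id)
    moreover have "(\<Prod>j\<in>U. B j ((?t \<circ> \<gamma>) j)) = (\<Prod>j\<in>U. B j (\<gamma> j))"
      by (rule prod.cong) (auto simp: Transposition.transpose_def eq)
    ultimately show "of_int (sign (?t \<circ> \<gamma>)) * (\<Prod>j\<in>U. B j ((?t \<circ> \<gamma>) j)) =
        - (of_int (sign \<gamma>) * (\<Prod>j\<in>U. B j (\<gamma> j)))"
      by simp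
  qed
  also have "\<dots> = - ?S" by (simp add: sum_negf)
  finally show ?thesis by simp
qed

text \<open>
  Pairing the cofactors of column \<open>b\<close> with the entries of another column \<open>a\<close> is the Laplace
  expansion of the determinant of the matrix in which column \<open>b\<close> is overwritten by column \<open>a\<close>.
\<close>

lemma alien_cofactor_expansion:
  fixes A :: "'i \<Rightarrow> 'i \<Rightarrow> real"
  assumes U: "finite U" "a \<in> U" "b \<in> U" "a \<noteq> b"
  shows "(\<Sum>k\<in>U. leibniz_cofactor U A b k * A k a) = 0"
proof -
  define B where "B j l = A j (if l = b then a else l)" for j l
  let ?f = "\<lambda>\<gamma>. of_int (sign \<gamma>) * (\<Prod>j\<in>U. B j (\<gamma> j)) :: real"
  have fin: "finite {\<gamma>. \<gamma> permutes U}"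
    using U(1) by (rule finite_permutations)
  have "leibniz_cofactor U A b k * A k a = (\<Sum>\<gamma> | \<gamma> permutes U \<and> \<gamma> k = b. ?f \<gamma>)"
    if k: "k \<in> U" for k
    unfolding leibniz_cofactor_def sum_distrib_right
  proof (rule sum.cong[OF refl])
    fix \<gamma> assume "\<gamma> \<in> {\<gamma>. \<gamma> permutes U \<and> \<gamma> k = b}"
    then have g: "\<gamma> permutes U" "\<gamma> k = b" by auto
    have "\<gamma> j \<noteq> b" if "j \<noteq> k" for j
      using that g permutes_inj[OF g(1)] by (metis injD)
    then have "(\<Prod>j\<in>U - {k}. B j (\<gamma> j)) = (\<Prod>j\<in>U - {k}. A j (\<gamma> j))"
      by (intro prod.cong) (auto simp: B_def)
    then have "(\<Prod>j\<in>U. B j (\<gamma> j)) = A k a * (\<Prod>j\<in>U - {k}. A j (\<gamma> j))"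
      using k U(1) g(2) by (simp add: prod.remove[of U k] B_def)
    then show "of_int (sign \<gamma>) * (\<Prod>j\<in>U - {k}. A j (\<gamma> j)) * A k a = ?f \<gamma>"
      by simp
  qed
  then have "(\<Sum>k\<in>U. leibniz_cofactor U A b k * A k a) =
      (\<Sum>k\<in>U. \<Sum>\<gamma> | \<gamma> permutes U \<and> \<gamma> k = b. ?f \<gamma>)"
    by (rule sum.cong[OF refl])
  \<comment> \<open>the permutations are grouped by the row that they send to column \<open>b\<close>\<close>
  also have "\<dots> = (\<Sum>k\<in>U. \<Sum>\<gamma> \<in> {\<gamma> \<in> {\<gamma>. \<gamma> permutes U}. inv \<gamma> b = k}. ?f \<gamma>)"
    by (intro sum.cong refl arg_cong2[where f = sum])
       (auto simp: permutes_inverses permutes_inv_eq)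
  also have "\<dots> = (\<Sum>\<gamma> | \<gamma> permutes U. ?f \<gamma>)"
    by (rule sum.group[OF fin U(1)]) (use U(3) in \<open>auto simp: permutes_in_image permutes_inv\<close>)
  also have "\<dots> = 0"
    by (rule leibniz_sum_equal_columns[OF U]) (auto simp: B_def)
  finally show ?thesis .
qed

section \<open>Invariant vectors of irreducible matrices\<close>

lemma invariant_mat_power:
  fixes P :: "real ^ 's ^ 's::finite"
  assumes "v v* P = v"
  shows "v v* mat_power P m = v"
proof (induction m)
  case 0
  show ?case by (simp add: mat_power_def)
next
  case (Suc m)
  have "v v* mat_power P (Suc m) = (v v* mat_power P m) v* P"
    by (simp add: mat_power_def vector_matrix_mul_assoc)
  then show ?case using Suc assms by simp
qed

lemma mat_power_nonneg:
  fixes P :: "real ^ 's ^ 's::finite"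
  assumes "\<And>i j. 0 \<le> P $ i $ j"
  shows "0 \<le> mat_power P m $ i $ j"
proof (induction m arbitrary: i j)
  case 0
  show ?case by (simp add: mat_power_def mat_def)
next
  case (Suc m)
  then show ?case
    by (auto simp: mat_power_def matrix_matrix_mult_def assms intro!: sum_nonneg mult_nonneg_nonneg)
qed

text \<open>
  A positive entry of an invariant vector spreads to every state \<open>j\<close> reachable from it: the
  entry at \<open>j\<close> is a sum of nonnegative terms for a suitable power of the matrix, and one of these
  terms is positive.
\<close>

lemma irreducible_invariant_pos:
  fixes P :: "real ^ 's ^ 's::finite"
  assumes P: "\<And>i j. 0 \<le> P $ i $ j" "irreducible_matrix P"
    and v: "v v* P = v" "\<And>i. 0 \<le> v $ i" "0 < v $ i"
  shows "0 < v $ j"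
proof -
  obtain m where m: "0 < mat_power P m $ i $ j"
    using P(2) by (auto simp: irreducible_matrix_def)
  have "0 < mat_power P m $ i $ j * v $ i"
    using m v(3) by simp
  also have "\<dots> \<le> (\<Sum>l\<in>UNIV. mat_power P m $ l $ j * v $ l)"
    by (rule member_le_sum) (auto intro!: mult_nonneg_nonneg mat_power_nonneg P(1) v(2))
  also have "\<dots> = (v v* mat_power P m) $ j"
    by (simp add: vector_matrix_mult_def mult.commute)
  also have "\<dots> = v $ j"
    by (simp add: invariant_mat_power[OF v(1)])
  finally show ?thesis .
qed

text \<open>
  Subtracting from \<open>v\<close> the largest multiple of \<open>u\<close> that leaves a nonnegative vector produces an
  invariant vector with a zero entry. It vanishes altogether, because a positive entry elsewhere
  would spread to the zero entry.
\<close>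

lemma irreducible_invariant_unique:
  fixes P :: "real ^ 's ^ 's::finite"
  assumes P: "\<And>i j. 0 \<le> P $ i $ j" "irreducible_matrix P"
    and u: "u v* P = u" "\<And>i. 0 \<le> u $ i" "u \<noteq> 0"
    and v: "v v* P = v"
  obtains t where "v = t *\<^sub>R u"
proof -
  obtain i where "u $ i \<noteq> 0"
    using u(3) by (auto simp: vec_eq_iff)
  then have "0 < u $ i" using u(2)[of i] by simp
  then have pos: "0 < u $ j" for j
    by (rule irreducible_invariant_pos[OF P u(1,2)])
  define t where "t = Min (range (\<lambda>j. v $ j / u $ j))"
  have le: "t \<le> v $ j / u $ j" for j
    by (simp add: t_def)
  have "t \<in> range (\<lambda>j. v $ j / u $ j)"
    unfolding t_def by (rule Min_in) auto
  then obtain k where k: "t = v $ k / u $ k" by auto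
  define w where "w = v - t *\<^sub>R u"
  have "w v* P = v v* P - t *\<^sub>R (u v* P)"
    by (simp add: w_def vec_eq_iff vector_matrix_mult_def algebra_simps sum_subtractf sum_distrib_left)
  then have w: "w v* P = w"
    using u(1) v by (simp add: w_def)
  have nonneg: "0 \<le> w $ j" for j
    using le[of j] pos[of j] by (simp add: w_def pos_le_divide_eq)
  have "w $ k = 0"
    using pos[of k] by (simp add: w_def k)
  then have "\<not> 0 < w $ j" for j
    using irreducible_invariant_pos[OF P w nonneg, of j k] by auto
  then have "w = 0"
    using nonneg by (simp add: vec_eq_iff order_less_le)
  then show thesis
    using that[of t] by (simp add: w_def)
qed

section \<open>The numerator is an invariant vector\<close>

text \<open>
  The matrix \<open>A\<close> of the overview; its column \<open>n + 1\<close>, at which \<open>st\<close> and \<open>zero\<close> have no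
  meaning, is the one whose cofactors are taken, so it never enters.
\<close>

definition zero_mass ::
  "(nat \<Rightarrow> 's) \<Rightarrow> (nat \<Rightarrow> 'a) \<Rightarrow> (nat \<Rightarrow> ('s, 'a) policy) \<Rightarrow> (nat \<Rightarrow> 's pmf) \<Rightarrow> nat \<Rightarrow> nat \<Rightarrow> real" where
  "zero_mass st zero pol \<mu>s k j = (if pol k (st j) = zero j then pmf (\<mu>s k) (st j) else 0)"

text \<open>
  Dropping the condition \<open>pol j (st (\<gamma> j)) = zero (\<gamma> j)\<close> from \<open>Gamma_set\<close> only adds permutations
  whose product contains a vanishing entry of \<open>zero_mass\<close>.
\<close>

lemma numer_eq_cofactor_sum:
  "numer n st zero pol \<mu>s x =
     (\<Sum>k\<in>{1..n+1}. leibniz_cofactor {1..n+1} (zero_mass st zero pol \<mu>s) (n+1) k * pmf (\<mu>s k) x)"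
proof -
  let ?U = "{1..n+1}" and ?A = "zero_mass st zero pol \<mu>s"
  have "(\<Sum>\<gamma>\<in>Gamma_set n st zero pol k.
          of_int (sign \<gamma>) * pmf (\<mu>s k) x * (\<Prod>j\<in>?U - {k}. pmf (\<mu>s j) (st (\<gamma> j)))) =
        leibniz_cofactor ?U ?A (n+1) k * pmf (\<mu>s k) x" for k
  proof -
    have "(\<Sum>\<gamma>\<in>Gamma_set n st zero pol k.
            of_int (sign \<gamma>) * pmf (\<mu>s k) x * (\<Prod>j\<in>?U - {k}. pmf (\<mu>s j) (st (\<gamma> j)))) =
          (\<Sum>\<gamma>\<in>Gamma_set n st zero pol k.
            of_int (sign \<gamma>) * (\<Prod>j\<in>?U - {k}. ?A j (\<gamma> j)) * pmf (\<mu>s k) x)"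
    proof (rule sum.cong[OF refl])
      fix \<gamma> assume "\<gamma> \<in> Gamma_set n st zero pol k"
      then have "(\<Prod>j\<in>?U - {k}. ?A j (\<gamma> j)) = (\<Prod>j\<in>?U - {k}. pmf (\<mu>s j) (st (\<gamma> j)))"
        by (intro prod.cong) (auto simp: Gamma_set_def zero_mass_def)
      then show "of_int (sign \<gamma>) * pmf (\<mu>s k) x * (\<Prod>j\<in>?U - {k}. pmf (\<mu>s j) (st (\<gamma> j))) =
          of_int (sign \<gamma>) * (\<Prod>j\<in>?U - {k}. ?A j (\<gamma> j)) * pmf (\<mu>s k) x"
        by simp
    qed
    also have "\<dots> = (\<Sum>\<gamma> | \<gamma> permutes ?U \<and> \<gamma> k = n + 1.
            of_int (sign \<gamma>) * (\<Prod>j\<in>?U - {k}. ?A j (\<gamma> j)) * pmf (\<mu>s k) x)"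
    proof (rule sum.mono_neutral_left)
      show "finite {\<gamma>. \<gamma> permutes ?U \<and> \<gamma> k = n + 1}"
        by (rule finite_subset[OF _ finite_permutations[of ?U]]) auto
      show "Gamma_set n st zero pol k \<subseteq> {\<gamma>. \<gamma> permutes ?U \<and> \<gamma> k = n + 1}"
        by (auto simp: Gamma_set_def)
      show "\<forall>\<gamma>\<in>{\<gamma>. \<gamma> permutes ?U \<and> \<gamma> k = n + 1} - Gamma_set n st zero pol k.
          of_int (sign \<gamma>) * (\<Prod>j\<in>?U - {k}. ?A j (\<gamma> j)) * pmf (\<mu>s k) x = 0"
      proof
        fix \<gamma> assume "\<gamma> \<in> {\<gamma>. \<gamma> permutes ?U \<and> \<gamma> k = n + 1} - Gamma_set n st zero pol k"
        then obtain j where "j \<in> ?U - {k}" "pol j (st (\<gamma> j)) \<noteq> zero (\<gamma> j)"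
          unfolding Gamma_set_def by blast
        then have "(\<Prod>j\<in>?U - {k}. ?A j (\<gamma> j)) = 0"
          by (intro prod_zero) (auto simp: zero_mass_def)
        then show "of_int (sign \<gamma>) * (\<Prod>j\<in>?U - {k}. ?A j (\<gamma> j)) * pmf (\<mu>s k) x = 0"
          by simp
      qed
    qed
    finally show ?thesis
      by (simp add: leibniz_cofactor_def sum_distrib_right)
  qed
  then show ?thesis
    by (simp add: numer_def)
qed

lemma stationary_distribution_iff:
  "stationary_distribution M \<pi> \<mu> \<longleftrightarrow>
     (\<forall>y. (\<Sum>x\<in>UNIV. pmf (trans M (\<pi> x) x) y * pmf \<mu> x) = pmf \<mu> y)"
  by (simp add: stationary_distribution_def transition_matrix_def vector_matrix_mult_def vec_eq_iff mult.commute)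

text \<open>
  Two policies that agree up to the states \<open>st j\<close>, where the second plays \<open>one j\<close> and the first
  \<open>zero j\<close> or \<open>one j\<close>, have transition matrices that differ only in the rows in which the first
  plays \<open>zero j\<close>; so only these rows contribute to the defect.
\<close>

lemma stationary_defect:
  fixes M :: "('s::finite, 'a::finite) mdp"
  assumes inj: "inj_on st {1..n}"
    and out: "\<And>x. x \<notin> st ` {1..n} \<Longrightarrow> pol k x = \<pi> x"
    and zo: "\<And>j. j \<in> {1..n} \<Longrightarrow> pol k (st j) = zero j \<or> pol k (st j) = one j"
    and one: "\<And>j. j \<in> {1..n} \<Longrightarrow> \<pi> (st j) = one j"
    and stat: "stationary_distribution M (pol k) (\<mu>s k)"
  shows "(\<Sum>x\<in>UNIV. pmf (trans M (\<pi> x) x) y * pmf (\<mu>s k) x) = pmf (\<mu>s k) y +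
    (\<Sum>j\<in>{1..n}. zero_mass st zero pol \<mu>s k j *
       (pmf (trans M (one j) (st j)) y - pmf (trans M (zero j) (st j)) y))"
proof -
  let ?D = "\<lambda>x. (pmf (trans M (\<pi> x) x) y - pmf (trans M (pol k x) x) y) * pmf (\<mu>s k) x"
  have "(\<Sum>x\<in>UNIV. pmf (trans M (\<pi> x) x) y * pmf (\<mu>s k) x) - pmf (\<mu>s k) y =
      (\<Sum>x\<in>UNIV. pmf (trans M (\<pi> x) x) y * pmf (\<mu>s k) x) -
      (\<Sum>x\<in>UNIV. pmf (trans M (pol k x) x) y * pmf (\<mu>s k) x)"
    using stat by (simp add: stationary_distribution_iff)
  also have "\<dots> = (\<Sum>x\<in>UNIV. ?D x)"
    by (simp add: sum_subtractf left_diff_distrib)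
  also have "\<dots> = (\<Sum>x\<in>st ` {1..n}. ?D x)"
    by (rule sum.mono_neutral_right) (auto simp: out)
  also have "\<dots> = (\<Sum>j\<in>{1..n}. ?D (st j))"
    using inj by (simp add: sum.reindex)
  also have "\<dots> = (\<Sum>j\<in>{1..n}. zero_mass st zero pol \<mu>s k j *
       (pmf (trans M (one j) (st j)) y - pmf (trans M (zero j) (st j)) y))"
  proof (rule sum.cong[OF refl])
    fix j assume "j \<in> {1..n}"
    then show "?D (st j) = zero_mass st zero pol \<mu>s k j *
       (pmf (trans M (one j) (st j)) y - pmf (trans M (zero j) (st j)) y)"
      using zo[of j] one[of j] by (auto simp: zero_mass_def)
  qed
  finally show ?thesis by simp
qed

text \<open>
  In the combination of the defects with the cofactors as coefficients, the coefficient of each row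
  difference is an alien cofactor expansion.
\<close>

lemma numer_invariant:
  fixes M :: "('s::finite, 'a::finite) mdp"
  assumes inj: "inj_on st {1..n}"
    and out: "\<And>k x. k \<in> {1..n+1} \<Longrightarrow> x \<notin> st ` {1..n} \<Longrightarrow> pol k x = \<pi> x"
    and zo: "\<And>k j. k \<in> {1..n+1} \<Longrightarrow> j \<in> {1..n} \<Longrightarrow> pol k (st j) = zero j \<or> pol k (st j) = one j"
    and one: "\<And>j. j \<in> {1..n} \<Longrightarrow> \<pi> (st j) = one j"
    and stat: "\<And>k. k \<in> {1..n+1} \<Longrightarrow> stationary_distribution M (pol k) (\<mu>s k)"
  shows "(\<chi> x. numer n st zero pol \<mu>s x) v* transition_matrix M \<pi> = (\<chi> x. numer n st zero pol \<mu>s x)"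
proof -
  let ?A = "zero_mass st zero pol \<mu>s"
  let ?c = "leibniz_cofactor {1..n+1} ?A (n+1)"
  let ?d = "\<lambda>j y. pmf (trans M (one j) (st j)) y - pmf (trans M (zero j) (st j)) y"
  have "(\<Sum>x\<in>UNIV. pmf (trans M (\<pi> x) x) y * numer n st zero pol \<mu>s x) = numer n st zero pol \<mu>s y"
    for y
  proof -
    have "(\<Sum>x\<in>UNIV. pmf (trans M (\<pi> x) x) y * numer n st zero pol \<mu>s x) =
        (\<Sum>x\<in>UNIV. \<Sum>k\<in>{1..n+1}. ?c k * (pmf (trans M (\<pi> x) x) y * pmf (\<mu>s k) x))"
      unfolding numer_eq_cofactor_sum sum_distrib_left by (simp only: mult.left_commute)
    also have "\<dots> = (\<Sum>k\<in>{1..n+1}. \<Sum>x\<in>UNIV. ?c k * (pmf (trans M (\<pi> x) x) y * pmf (\<mu>s k) x))"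
      by (rule sum.swap)
    also have "\<dots> = (\<Sum>k\<in>{1..n+1}. ?c k * (\<Sum>x\<in>UNIV. pmf (trans M (\<pi> x) x) y * pmf (\<mu>s k) x))"
      by (simp only: sum_distrib_left)
    also have "\<dots> = (\<Sum>k\<in>{1..n+1}. ?c k * (pmf (\<mu>s k) y + (\<Sum>j\<in>{1..n}. ?A k j * ?d j y)))"
    proof (rule sum.cong[OF refl])
      fix k assume k: "k \<in> {1..n+1}"
      show "?c k * (\<Sum>x\<in>UNIV. pmf (trans M (\<pi> x) x) y * pmf (\<mu>s k) x) =
          ?c k * (pmf (\<mu>s k) y + (\<Sum>j\<in>{1..n}. ?A k j * ?d j y))"
        by (intro arg_cong[where f = "(*) (?c k)"] stationary_defect inj out zo one stat k)
    qed
    also have "\<dots> = (\<Sum>k\<in>{1..n+1}. ?c k * pmf (\<mu>s k) y) +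
        (\<Sum>k\<in>{1..n+1}. \<Sum>j\<in>{1..n}. ?c k * ?A k j * ?d j y)"
      by (simp only: distrib_left sum.distrib sum_distrib_left mult.assoc)
    also have "(\<Sum>k\<in>{1..n+1}. \<Sum>j\<in>{1..n}. ?c k * ?A k j * ?d j y) =
        (\<Sum>j\<in>{1..n}. (\<Sum>k\<in>{1..n+1}. ?c k * ?A k j) * ?d j y)"
      unfolding sum_distrib_right by (rule sum.swap)
    also have "\<dots> = 0"
    proof (rule sum.neutral, rule ballI)
      fix j assume "j \<in> {1..n}"
      then have "(\<Sum>k\<in>{1..n+1}. ?c k * ?A k j) = 0"
        by (intro alien_cofactor_expansion) auto
      then show "(\<Sum>k\<in>{1..n+1}. ?c k * ?A k j) * ?d j y = 0" by simp
    qed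
    finally show ?thesis
      by (simp add: numer_eq_cofactor_sum)
  qed
  then show ?thesis
    by (simp add: transition_matrix_def vector_matrix_mult_def vec_eq_iff mult.commute)
qed

lemma stationary_distribution_unique_multiple:
  fixes M :: "('s::finite, 'a::finite) mdp"
  assumes "unichain M" and stat: "stationary_distribution M \<pi> \<mu>"
    and f: "(\<chi> x. f x) v* transition_matrix M \<pi> = (\<chi> x. f x)"
  shows "pmf \<mu> x * (\<Sum>y\<in>UNIV. f y) = f x"
proof -
  have sum_1: "(\<Sum>y\<in>UNIV. pmf \<mu> y) = 1"
    by (rule sum_pmf_eq_1) auto
  obtain t where "(\<chi> x. f x) = t *\<^sub>R (\<chi> x. pmf \<mu> x)"
  proof (rule irreducible_invariant_unique[OF _ _ _ _ _ f])
    show "irreducible_matrix (transition_matrix M \<pi>)"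
      using assms(1) by (simp add: unichain_def)
    show "(\<chi> x. pmf \<mu> x) v* transition_matrix M \<pi> = (\<chi> x. pmf \<mu> x)"
      using stat by (simp add: stationary_distribution_def)
    show "(\<chi> x. pmf \<mu> x) \<noteq> 0"
    proof
      assume "(\<chi> x. pmf \<mu> x) = 0"
      then have "pmf \<mu> x = 0" for x by (simp add: vec_eq_iff)
      then show False using sum_1 by simp
    qed
  qed (auto simp: transition_matrix_def)
  then have f_eq: "f x = t * pmf \<mu> x" for x
    by (simp add: vec_eq_iff)
  then have "(\<Sum>y\<in>UNIV. f y) = t"
    using sum_1 by (simp flip: sum_distrib_left)
  then show ?thesis
    by (simp add: f_eq)
qed

section \<open>Stationary distributions of combinations\<close>

theorem theorem2p1:
  fixes M :: "('s::finite, 'a::finite) mdp"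
    and n :: nat
    and st :: "nat \<Rightarrow> 's"
    and pol :: "nat \<Rightarrow> ('s, 'a) policy"
    and act0 act1 :: "nat \<Rightarrow> 'a"
    and \<mu>s :: "nat \<Rightarrow> 's pmf"
  assumes "unichain M"
    and "inj_on st {1..n}"
    and "inj_on pol {1..n+1}"
    and "\<forall>i\<in>{1..n+1}. \<forall>i'\<in>{1..n+1}. \<forall>x. x \<notin> st ` {1..n} \<longrightarrow> pol i x = pol i' x"
    and "\<forall>j\<in>{1..n}. act0 j \<noteq> act1 j"
    and "\<forall>i\<in>{1..n+1}. \<forall>j\<in>{1..n}. pol i (st j) = act0 j \<or> pol i (st j) = act1 j"
    and "\<forall>i\<in>{1..n+1}. stationary_distribution M (pol i) (\<mu>s i)"
  shows "\<forall>\<pi> zero one \<mu>.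
    combination (n + 1) pol \<pi> \<and>
    (\<forall>j\<in>{1..n}. {zero j, one j} = {act0 j, act1 j} \<and> \<pi> (st j) = one j) \<and>
    stationary_distribution M \<pi> \<mu> \<longrightarrow>
      (\<forall>x. pmf \<mu> x * (\<Sum>y\<in>UNIV. numer n st zero pol \<mu>s y) = numer n st zero pol \<mu>s x) \<and>
      ((\<Sum>y\<in>UNIV. numer n st zero pol \<mu>s y) \<noteq> 0 \<longrightarrow>
        (\<forall>x. pmf \<mu> x = numer n st zero pol \<mu>s x / (\<Sum>y\<in>UNIV. numer n st zero pol \<mu>s y)) \<and>
        (\<forall>M' :: ('s, 'a) mdp. \<forall>\<mu>'.
           unichain M' \<and> (\<forall>i\<in>{1..n+1}. stationary_distribution M' (pol i) (\<mu>s i)) \<and>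
           stationary_distribution M' \<pi> \<mu>' \<longrightarrow> \<mu>' = \<mu>))"
proof (intro allI impI, elim conjE)
  fix \<pi> :: "('s, 'a) policy" and zero one :: "nat \<Rightarrow> 'a" and \<mu> :: "'s pmf"
  assume comb: "combination (n + 1) pol \<pi>"
    and names: "\<forall>j\<in>{1..n}. {zero j, one j} = {act0 j, act1 j} \<and> \<pi> (st j) = one j"
    and stat: "stationary_distribution M \<pi> \<mu>"
  let ?N = "numer n st zero pol \<mu>s"
  have out: "pol k x = \<pi> x" if "k \<in> {1..n+1}" "x \<notin> st ` {1..n}" for k x
    using comb assms(4) that unfolding combination_def by metis
  have zo: "pol k (st j) = zero j \<or> pol k (st j) = one j" if "k \<in> {1..n+1}" "j \<in> {1..n}" for k j
    using names assms(6) that by blast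
  have one: "\<pi> (st j) = one j" if "j \<in> {1..n}" for j
    using names that by blast
  \<comment> \<open>stated for every unichain process, since the uniqueness claim needs it for \<open>M'\<close> as well\<close>
  have key: "pmf \<nu> x * (\<Sum>y\<in>UNIV. ?N y) = ?N x"
    if "unichain M'" "\<forall>i\<in>{1..n+1}. stationary_distribution M' (pol i) (\<mu>s i)"
      "stationary_distribution M' \<pi> \<nu>" for M' :: "('s, 'a) mdp" and \<nu> x
    using that(2)
    by (intro stationary_distribution_unique_multiple[OF that(1,3)]
        numer_invariant[where one = one] assms(2) out zo one) auto
  note key_M = key[OF assms(1) assms(7) stat]
  show "(\<forall>x. pmf \<mu> x * (\<Sum>y\<in>UNIV. ?N y) = ?N x) \<and>
      ((\<Sum>y\<in>UNIV. ?N y) \<noteq> 0 \<longrightarrow>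
        (\<forall>x. pmf \<mu> x = ?N x / (\<Sum>y\<in>UNIV. ?N y)) \<and>
        (\<forall>M' :: ('s, 'a) mdp. \<forall>\<mu>'.
           unichain M' \<and> (\<forall>i\<in>{1..n+1}. stationary_distribution M' (pol i) (\<mu>s i)) \<and>
           stationary_distribution M' \<pi> \<mu>' \<longrightarrow> \<mu>' = \<mu>))"
  proof (intro conjI impI allI)
    fix x
    show "pmf \<mu> x * (\<Sum>y\<in>UNIV. ?N y) = ?N x" by (rule key_M)
  next
    fix x
    assume "(\<Sum>y\<in>UNIV. ?N y) \<noteq> 0"
    then show "pmf \<mu> x = ?N x / (\<Sum>y\<in>UNIV. ?N y)"
      using key_M[of x] by (simp add: eq_divide_eq)
  next
    fix M' :: "('s, 'a) mdp" and \<mu>'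
    assume nz: "(\<Sum>y\<in>UNIV. ?N y) \<noteq> 0"
      and "unichain M' \<and> (\<forall>i\<in>{1..n+1}. stationary_distribution M' (pol i) (\<mu>s i)) \<and>
        stationary_distribution M' \<pi> \<mu>'"
    then have "pmf \<mu>' x * (\<Sum>y\<in>UNIV. ?N y) = ?N x" for x
      by (intro key) auto
    then have "pmf \<mu>' x = pmf \<mu> x" for x
      using nz key_M[of x] by (metis mult_right_cancel)
    then show "\<mu>' = \<mu>"
      by (rule pmf_eqI)
  qed
qed

end
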